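(* For every $s\in\mathbb{C}$ the series $\sum_{n=0}^\infty (-1)^n b_n\binom{s}{n}$ converges, and $$\zeta(s)-\frac{1}{s-1}=\sum_{n=0}^\infty (-1)^n b_n \binom{s}{n},$$ where at $s=1$ the left-hand side is understood as its limiting value $\gamma$.
   Context: $\zeta$ is the Riemann zeta function (analytically continued), $\gamma$ is Euler's constant, $H_n=1+\frac12+\cdots+\frac1n$ with $H_0=0$, and $\binom{s}{n}=\frac{s(s-1)\cdots(s-n+1)}{n!}$ for $s\in\mathbb{C}$ (with $\binom{s}{0}=1$). The coefficients are $b_n=\sum_{k=0}^n\binom{n}{k}(-1)^k Z(k)$, where $Z(s)=\zeta(s)-\frac1{s-1}$ for $s\neq1$ and $Z(1)=\gamma$. Thus $b_0=Z(0)=\frac12$, and for $n\ge1$ $$b_n = n(1-\gamma-H_{n-1})-\frac12+\sum_{k=2}^n \binom{n}{k}(-1)^k\zeta(k).$$ *)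

theory Defs
  imports "HOL-Complex_Analysis.Complex_Analysis"
begin

definition is_zeta_continuation :: "(complex \<Rightarrow> complex) \<Rightarrow> bool" where
  "is_zeta_continuation f \<longleftrightarrow>
     f holomorphic_on - {1} \<and>
     (\<forall>s. Re s > 1 \<longrightarrow> (\<lambda>n. 1 / of_nat (Suc n) powr s) sums f s)"

(* The continuation is determined only away from the pole, so the value at 1 is left
   unspecified; zeta_eqI shows that the choice is immaterial elsewhere. *)
definition zeta :: "complex \<Rightarrow> complex" where
  "zeta = (SOME f. is_zeta_continuation f)"

lemma zeta_eqI:
  assumes f: "is_zeta_continuation f" and s: "s \<noteq> 1"
  shows "zeta s = f s"
proof (rule analytic_continuation_open[of "{s. Re s > 1}" "- {1}" zeta f])
  have z: "is_zeta_continuation zeta"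
    unfolding zeta_def by (rule someI[of is_zeta_continuation, OF f])
  show "zeta holomorphic_on - {1}" "f holomorphic_on - {1}"
    using z f by (auto simp: is_zeta_continuation_def)
  show "zeta w = f w" if "w \<in> {s. Re s > 1}" for w
    using z f that by (auto simp: is_zeta_continuation_def intro: sums_unique2)
  show "open {s. Re s > 1}" by (rule open_halfspace_Re_gt)
  show "{s. Re s > 1} \<noteq> {}" by (auto intro: exI[of _ 2])
  show "connected (- {1 :: complex})"
    by (rule connected_punctured_universe) auto
qed (use s in auto)

definition zeta_reg :: "complex \<Rightarrow> complex" where
  "zeta_reg s = (if s = 1 then euler_mascheroni else zeta s - 1 / (s - 1))"

definition newton_coeff :: "nat \<Rightarrow> complex" where
  "newton_coeff n = (\<Sum>k\<le>n. of_nat (n choose k) * (-1) ^ k * zeta_reg (of_nat k))"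

end

(* Every value Z(s) is 1/2 plus the integral over [1, \<infinity>) of the sawtooth frac x - 1/2 against the
   derivative of x^(-s) (the trapezoidal form of Euler-Maclaurin), so b_n is n times the integral of the
   sawtooth against (1/x)^2 (1 - 1/x)^(n-1). Repeated integration by parts against periodic functions
   of mean zero has no boundary terms, and each step gains a factor 1/n, so b_n decays faster than
   every power of n. Hence the Newton series is entire. For real s in (1,2) it equals Z(s) by the
   binomial series of x^(1-s) = (1 - (1 - 1/x))^(s-1), hence it is the analytic continuation of Z.
   The integrals serve as the definition of b_n; that they are the coefficients of the statement
   follows afterwards by binomial inversion at the nonnegative integers. *)

theory Submission
  imports Defs
begin

section \<open>Integrals over [1, \<infinity>) against a periodic weight\<close>

text \<open>Cell \<open>m\<close> is [m+1, m+2], shifted to [0,1], so the weight is an ordinary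
  function on [0,1]. Its periodic extension, which may jump at integers, never has to be
  formed.\<close>

definition cell_integral :: "(real \<Rightarrow> real) \<Rightarrow> (real \<Rightarrow> real) \<Rightarrow> nat \<Rightarrow> real" where
  "cell_integral p f m = integral {0..1} (\<lambda>u. p u * f (real (Suc m) + u))"

(* The integral of p(frac x) * f x over [1, \<infinity>), summed cell by cell; meant for f = O(1/x^2). *)
definition periodic_integral :: "(real \<Rightarrow> real) \<Rightarrow> (real \<Rightarrow> real) \<Rightarrow> real" where
  "periodic_integral p f = (\<Sum>m. cell_integral p f m)"

lemma inverse_squares_Suc_sums: "(\<lambda>m. 1 / real (Suc m) ^ 2) sums (pi\<^sup>2 / 6)"
  using inverse_squares_sums by (simp add: add.commute)

lemma cell_integrand_continuous:
  fixes p f :: "real \<Rightarrow> real"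
  assumes "continuous_on {0..1} p" "continuous_on {1..} f"
  shows "continuous_on {0..1} (\<lambda>u. p u * f (real (Suc m) + u))"
  by (intro continuous_intros assms continuous_on_compose2[OF assms(2)]) auto

lemma cell_integral_bound:
  assumes p: "continuous_on {0..1} p" "\<And>u. u \<in> {0..1} \<Longrightarrow> \<bar>p u\<bar> \<le> B"
    and f: "continuous_on {1..} f" "\<And>x. x \<ge> 1 \<Longrightarrow> \<bar>f x\<bar> \<le> C / x ^ 2"
  shows "\<bar>cell_integral p f m\<bar> \<le> B * C * (1 / real (Suc m) ^ 2)"
proof -
  have B: "B \<ge> 0" using p(2)[of 0] by auto
  have C: "C \<ge> 0" using f(2)[of 1] by auto
  have "norm (integral {0..1} (\<lambda>u. p u * f (real (Suc m) + u)))
      \<le> B * C * (1 / real (Suc m) ^ 2) * (1 - 0)"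
  proof (rule integral_bound)
    fix u :: real assume u: "u \<in> {0..1}"
    have "\<bar>f (real (Suc m) + u)\<bar> \<le> C / (real (Suc m) + u) ^ 2"
      using u by (intro f) auto
    also have "\<dots> \<le> C / real (Suc m) ^ 2"
      using u C by (intro divide_left_mono power_mono) auto
    finally show "norm (p u * f (real (Suc m) + u)) \<le> B * C * (1 / real (Suc m) ^ 2)"
      using mult_mono[OF p(2)[OF u], of "\<bar>f (real (Suc m) + u)\<bar>" "C / real (Suc m) ^ 2"] B
      by (simp add: abs_mult)
  qed (use cell_integrand_continuous[OF p(1) f(1)] in auto)
  then show ?thesis by (simp add: cell_integral_def)
qed

lemma summable_cell_integral:
  assumes p: "continuous_on {0..1} p"
    and f: "continuous_on {1..} f" "\<And>x. x \<ge> 1 \<Longrightarrow> \<bar>f x\<bar> \<le> C / x ^ 2"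
  shows "summable (cell_integral p f)"
proof -
  have "bounded (p ` {0..1})"
    using p compact_continuous_image compact_imp_bounded by blast
  then obtain B where B: "\<And>u. u \<in> {0..1} \<Longrightarrow> \<bar>p u\<bar> \<le> B"
    unfolding bounded_iff by fastforce
  show ?thesis
  proof (rule summable_comparison_test')
    show "summable (\<lambda>m. B * C * (1 / real (Suc m) ^ 2))"
      by (intro summable_mult sums_summable[OF inverse_squares_Suc_sums])
    show "norm (cell_integral p f m) \<le> B * C * (1 / real (Suc m) ^ 2)" if "m \<ge> 0" for m
      using cell_integral_bound[OF p B f] by simp
  qed
qed

lemma periodic_integral_sums:
  assumes "continuous_on {0..1} p" "continuous_on {1..} f" "\<And>x. x \<ge> 1 \<Longrightarrow> \<bar>f x\<bar> \<le> C / x ^ 2"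
  shows "cell_integral p f sums periodic_integral p f"
  unfolding periodic_integral_def using summable_cell_integral[OF assms] by (rule summable_sums)

text \<open>On cell \<open>m\<close> the factor 1/x^2 is largest at the left end m+1, and these
  maxima sum to pi^2/6. Linearity of the bound in \<open>C\<close> is what turns pointwise estimates
  of kernels and remainders into estimates of integrals.\<close>

lemma periodic_integral_bound:
  assumes p: "continuous_on {0..1} p" "\<And>u. u \<in> {0..1} \<Longrightarrow> \<bar>p u\<bar> \<le> B"
    and f: "continuous_on {1..} f" "\<And>x. x \<ge> 1 \<Longrightarrow> \<bar>f x\<bar> \<le> C / x ^ 2"
  shows "\<bar>periodic_integral p f\<bar> \<le> B * C * (pi\<^sup>2 / 6)"
proof -
  have s: "(\<lambda>m. B * C * (1 / real (Suc m) ^ 2)) sums (B * C * (pi\<^sup>2 / 6))"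
    by (intro sums_mult inverse_squares_Suc_sums)
  have "norm (\<Sum>m. cell_integral p f m) \<le> (\<Sum>m. B * C * (1 / real (Suc m) ^ 2))"
    by (rule norm_suminf_le) (use cell_integral_bound[OF assms] s in \<open>auto simp: sums_iff\<close>)
  also have "\<dots> = B * C * (pi\<^sup>2 / 6)"
    using s by (rule sums_unique[symmetric])
  finally show ?thesis by (simp add: periodic_integral_def)
qed

lemma periodic_integral_cong:
  assumes "\<And>x. x \<ge> 1 \<Longrightarrow> f x = g x"
  shows "periodic_integral p f = periodic_integral p g"
  unfolding periodic_integral_def cell_integral_def
  by (intro suminf_cong integral_cong) (use assms in auto)

lemma periodic_integral_cmult:
  assumes "continuous_on {0..1} p" "continuous_on {1..} f" "\<And>x. x \<ge> 1 \<Longrightarrow> \<bar>f x\<bar> \<le> C / x ^ 2"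
  shows "periodic_integral p (\<lambda>x. c * f x) = c * periodic_integral p f"
proof -
  have "cell_integral p (\<lambda>x. c * f x) m = c * cell_integral p f m" for m
    by (simp add: cell_integral_def mult.left_commute)
  then show ?thesis
    using suminf_mult[OF summable_cell_integral[OF assms]] by (simp add: periodic_integral_def)
qed

lemma periodic_integral_add:
  assumes p: "continuous_on {0..1} p"
    and f: "continuous_on {1..} f" "\<And>x. x \<ge> 1 \<Longrightarrow> \<bar>f x\<bar> \<le> C / x ^ 2"
    and g: "continuous_on {1..} g" "\<And>x. x \<ge> 1 \<Longrightarrow> \<bar>g x\<bar> \<le> D / x ^ 2"
  shows "periodic_integral p (\<lambda>x. f x + g x) = periodic_integral p f + periodic_integral p g"
proof -
  have "cell_integral p (\<lambda>x. f x + g x) m = cell_integral p f m + cell_integral p g m" for m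
    unfolding cell_integral_def ring_distribs
    by (intro integral_add integrable_continuous_interval cell_integrand_continuous p f g)
  then show ?thesis
    using suminf_add[OF summable_cell_integral[OF p f] summable_cell_integral[OF p g]]
    by (simp add: periodic_integral_def)
qed

text \<open>Product rule and fundamental theorem on one cell. The end values \<open>P 1\<close> and
  \<open>P 0\<close> stay separate because the sawtooth takes different values there.\<close>

lemma cell_integral_by_parts:
  assumes p: "continuous_on {0..1} p"
    and P: "\<And>u. u \<in> {0..1} \<Longrightarrow> (P has_real_derivative p u) (at u within {0..1})"
    and f: "\<And>x. x \<ge> 1 \<Longrightarrow> (f has_real_derivative f' x) (at x)"
    and f': "continuous_on {1..} f'"
  shows "cell_integral p f m
    = P 1 * f (real (Suc (Suc m))) - P 0 * f (real (Suc m)) - cell_integral P f' m"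
proof -
  have cf: "continuous_on {1..} f"
    by (intro continuous_at_imp_continuous_on ballI) (auto intro: DERIV_isCont f)
  have cP: "continuous_on {0..1} P"
    using P by (rule DERIV_continuous_on)
  define F where "F = (\<lambda>u. P u * f (real (Suc m) + u))"
  define F' where "F' = (\<lambda>u. p u * f (real (Suc m) + u) + P u * f' (real (Suc m) + u))"
  have "(F' has_integral (F 1 - F 0)) {0..1}"
  proof (rule fundamental_theorem_of_calculus)
    fix u :: real assume u: "u \<in> {0..1}"
    have "((\<lambda>u. f (real (Suc m) + u)) has_real_derivative f' (real (Suc m) + u)) (at u within {0..1})"
      by (rule DERIV_chain2[THEN DERIV_cong, OF f]) (use u in \<open>auto intro!: derivative_eq_intros\<close>)
    from DERIV_mult[OF P[OF u] this]
    show "(F has_vector_derivative F' u) (at u within {0..1})"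
      unfolding has_real_derivative_iff_has_vector_derivative[symmetric] F_def F'_def
      by (simp add: mult.commute add.commute)
  qed auto
  then have "integral {0..1} F' = F 1 - F 0"
    by (rule integral_unique)
  moreover have "integral {0..1} F' = cell_integral p f m + cell_integral P f' m"
    unfolding F'_def cell_integral_def
    by (intro integral_add integrable_continuous_interval cell_integrand_continuous p cP cf f')
  ultimately show ?thesis
    by (simp add: F_def algebra_simps)
qed

section \<open>The kernels and their derivatives\<close>

text \<open>In y = 1/x this is y^2 * y^j * (1-y)^c. The factor y^2 secures integrability,
  \<open>j\<close> counts the further powers of y produced by differentiation, and
  \<open>j = 0\<close>, \<open>c = n - 1\<close> is the kernel of b_n / n.\<close>

definition newton_kernel :: "nat \<Rightarrow> nat \<Rightarrow> real \<Rightarrow> real" where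
  "newton_kernel j c x = (1 / x) ^ (j + 2) * (1 - 1 / x) ^ c"

lemma newton_kernel_continuous: "continuous_on {1..} (newton_kernel j c)"
  unfolding newton_kernel_def[abs_def] by (intro continuous_intros) auto

text \<open>With y = 1/x in [0,1], the number binom(j+c, j) y^j (1-y)^c is one nonnegative term of
  the expansion of (y + (1-y))^(j+c) = 1, and the binomial coefficient is at least (c+1)^j /
  j!.\<close>

lemma newton_kernel_bound:
  assumes "x \<ge> 1"
  shows "\<bar>newton_kernel j c x\<bar> \<le> fact j / real (c + 1) ^ j / x ^ 2"
proof -
  define y where "y = 1 / x"
  have y: "0 \<le> y" "y \<le> 1" using assms by (auto simp: y_def)
  have le1: "real ((j + c) choose j) * y ^ j * (1 - y) ^ c \<le> 1"
  proof -
    have "real ((j + c) choose j) * y ^ j * (1 - y) ^ ((j + c) - j)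
        \<le> (\<Sum>k\<le>j + c. real ((j + c) choose k) * y ^ k * (1 - y) ^ ((j + c) - k))"
      using y by (intro member_le_sum) auto
    also have "\<dots> = (y + (1 - y)) ^ (j + c)"
      by (rule binomial_ring[symmetric])
    finally show ?thesis by simp
  qed
  \<comment> \<open>The right-hand side is the product (c+1)(c+2)...(c+j), all of whose factors are
    at least c+1.\<close>
  have "real (c + 1) ^ j \<le> fact j * real ((j + c) choose j)"
  proof (induction j)
    case (Suc j)
    have "real (c + 1) ^ Suc j \<le> real (Suc (j + c)) * (fact j * real ((j + c) choose j))"
      using Suc by (simp del: of_nat_Suc of_nat_add) (intro mult_mono, auto)
    also have "\<dots> = fact j * real (Suc (j + c) * ((j + c) choose j))"
      by (simp only: of_nat_mult mult_ac)
    also have "Suc (j + c) * ((j + c) choose j) = (Suc (j + c) choose Suc j) * Suc j"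
      by (rule Suc_times_binomial_eq)
    finally show ?case by (simp only: fact_Suc of_nat_mult mult_ac add_Suc)
  qed auto
  then have "real (c + 1) ^ j * (y ^ j * (1 - y) ^ c)
      \<le> fact j * real ((j + c) choose j) * (y ^ j * (1 - y) ^ c)"
    using y by (intro mult_right_mono) auto
  also have "\<dots> \<le> fact j"
    using mult_left_mono[OF le1, of "fact j"] by (simp add: mult.assoc)
  finally have "y ^ j * (1 - y) ^ c \<le> fact j / real (c + 1) ^ j"
    by (simp add: pos_le_divide_eq mult.commute)
  then have "y ^ j * (1 - y) ^ c * y ^ 2 \<le> fact j / real (c + 1) ^ j * y ^ 2"
    using y by (intro mult_right_mono) auto
  moreover have "newton_kernel j c x = y ^ j * (1 - y) ^ c * y ^ 2"
    unfolding newton_kernel_def y_def[symmetric] power_add by (simp only: mult_ac)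
  moreover have "y ^ j * (1 - y) ^ c * y ^ 2 \<ge> 0" using y by simp
  ultimately show ?thesis by (simp add: y_def power_one_over)
qed

text \<open>Chain rule through y = 1/x, where dy/dx = -y^2. The first term carries the large factor
  c+1 but gains two powers of y; the second gains one power with a factor independent of
  \<open>c\<close>. By \<open>newton_kernel_bound\<close> both are smaller than the original bound
  by about one power of \<open>c\<close>.\<close>

lemma newton_kernel_deriv:
  assumes "x \<ge> 1"
  shows "(newton_kernel j (Suc c) has_real_derivative
    real (Suc c) * newton_kernel (j + 2) c x - real (j + 2) * newton_kernel (j + 1) (Suc c) x) (at x)"
proof -
  define h where "h = (\<lambda>y :: real. y ^ (j + 2) * (1 - y) ^ Suc c)"
  have "(h has_real_derivative
      real (j + 2) * y ^ (j + 1) * (1 - y) ^ Suc c - y ^ (j + 2) * (real (Suc c) * (1 - y) ^ c)) (at y)" for y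
  proof -
    have "((\<lambda>y. y ^ (j + 2)) has_real_derivative real (j + 2) * y ^ (j + 1)) (at y)"
      using DERIV_pow[of "j + 2" y] by simp
    moreover have "((\<lambda>y. (1 - y) ^ Suc c) has_real_derivative (1 + real c) * (- 1 * (1 - y) ^ c)) (at y)"
      by (rule DERIV_power_Suc) (auto intro!: derivative_eq_intros)
    ultimately show ?thesis
      unfolding h_def by (rule DERIV_mult[THEN DERIV_cong]) (simp add: algebra_simps)
  qed
  moreover have "((\<lambda>x. 1 / x) has_real_derivative (- ((1 / x) ^ 2))) (at x)"
    using assms by (auto intro!: derivative_eq_intros simp: power2_eq_square)
  ultimately have "((\<lambda>x. h (1 / x)) has_real_derivative
      (real (j + 2) * (1 / x) ^ (j + 1) * (1 - 1 / x) ^ Suc c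
        - (1 / x) ^ (j + 2) * (real (Suc c) * (1 - 1 / x) ^ c)) * (- ((1 / x) ^ 2))) (at x)"
    by (rule DERIV_chain2)
  moreover have "newton_kernel j (Suc c) = (\<lambda>x. h (1 / x))"
    by (simp add: newton_kernel_def[abs_def] h_def)
  moreover have "(real (j + 2) * y ^ (j + 1) * (1 - y) ^ Suc c
        - y ^ (j + 2) * (real (Suc c) * (1 - y) ^ c)) * (- (y ^ 2))
      = real (Suc c) * (y ^ (j + 2 + 2) * (1 - y) ^ c)
        - real (j + 2) * (y ^ (j + 1 + 2) * (1 - y) ^ Suc c)" for y :: real
    by (simp add: algebra_simps power_add power2_eq_square)
  ultimately show ?thesis
    by (simp only: newton_kernel_def)
qed

section \<open>Repeated integration by parts and rapid decay\<close>

text \<open>Mean zero of \<open>p\<close> makes every antiderivative take equal values at 0 and 1;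
  subtracting the mean of one of them restores mean zero, so the construction can be iterated.
  Starting from the sawtooth this produces scaled Bernoulli polynomials.\<close>

lemma mean_zero_antiderivative:
  fixes p :: "real \<Rightarrow> real"
  assumes p: "continuous_on {0..1} p" and p0: "integral {0..1} p = 0"
  obtains P where "continuous_on {0..1} P" "integral {0..1} P = 0" "P 1 = P 0"
    "\<And>u. u \<in> {0..1} \<Longrightarrow> (P has_real_derivative p u) (at u within {0..1})"
proof -
  define Q where "Q = (\<lambda>u. integral {0..u} p)"
  define P where "P = (\<lambda>u. Q u - integral {0..1} Q)"
  have Q: "(Q has_real_derivative p u) (at u within {0..1})" if "u \<in> {0..1}" for u
    unfolding Q_def using p that by (rule integral_has_real_derivative)
  have P: "(P has_real_derivative p u) (at u within {0..1})" if "u \<in> {0..1}" for u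
    unfolding P_def using DERIV_diff[OF Q[OF that] DERIV_const] by simp
  have cQ: "continuous_on {0..1} Q" using Q by (rule DERIV_continuous_on)
  show ?thesis
  proof
    show "continuous_on {0..1} P" using P by (rule DERIV_continuous_on)
    show "integral {0..1} P = 0"
      unfolding P_def by (subst integral_diff) (auto intro: integrable_continuous_interval cQ)
    show "P 1 = P 0" by (simp add: P_def Q_def p0)
  qed (rule P)
qed

(* Since P is periodic, all boundary terms telescope, and they vanish at 1 and at infinity. *)
lemma periodic_integral_by_parts:
  assumes p: "continuous_on {0..1} p"
    and P: "\<And>u. u \<in> {0..1} \<Longrightarrow> (P has_real_derivative p u) (at u within {0..1})" "P 1 = P 0"
    and f: "\<And>x. x \<ge> 1 \<Longrightarrow> (f has_real_derivative f' x) (at x)"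
    and f': "continuous_on {1..} f'" "\<And>x. x \<ge> 1 \<Longrightarrow> \<bar>f' x\<bar> \<le> C / x ^ 2"
    and f1: "f 1 = 0" and finf: "(\<lambda>m. f (real (Suc m))) \<longlonglongrightarrow> 0"
  shows "periodic_integral p f = - periodic_integral P f'"
proof -
  have cP: "continuous_on {0..1} P" using P(1) by (rule DERIV_continuous_on)
  have "(\<lambda>m. P 0 * (f (real (Suc (Suc m))) - f (real (Suc m))) - cell_integral P f' m)
      sums (P 0 * (0 - f (real (Suc 0))) - periodic_integral P f')"
    by (intro sums_diff sums_mult telescope_sums finf periodic_integral_sums[OF cP f'])
  moreover have "cell_integral p f m
      = P 0 * (f (real (Suc (Suc m))) - f (real (Suc m))) - cell_integral P f' m" for m
    using cell_integral_by_parts[OF p P(1) f f'(1)] P(2) by (simp add: algebra_simps)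
  then have "cell_integral p f
      = (\<lambda>m. P 0 * (f (real (Suc (Suc m))) - f (real (Suc m))) - cell_integral P f' m)"
    by (rule ext)
  ultimately have "cell_integral p f sums (- periodic_integral P f')"
    using f1 by simp
  then show ?thesis
    unfolding periodic_integral_def[of p] by (rule sums_unique[symmetric])
qed

lemma newton_kernel_at_1: "newton_kernel j (Suc c) 1 = 0"
  by (simp add: newton_kernel_def)

lemma newton_kernel_tendsto_0: "(\<lambda>m. newton_kernel j c (real (Suc m))) \<longlonglongrightarrow> 0"
proof -
  have "(\<lambda>m. newton_kernel j c (real (Suc m))) \<longlonglongrightarrow> 0 ^ (j + 2) * (1 - 0) ^ c"
    unfolding newton_kernel_def by (intro tendsto_intros LIMSEQ_inverse_real_of_nat[unfolded inverse_eq_divide])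
  then show ?thesis by simp
qed

text \<open>Integration by parts stays within the family of kernels, at the cost of one factor 1 -
  1/x in the second term. The exponent \<open>Suc c\<close> provides the zero at x = 1 that removes
  the boundary term.\<close>

lemma periodic_integral_newton_kernel_Suc:
  assumes p: "continuous_on {0..1} p"
    and P: "\<And>u. u \<in> {0..1} \<Longrightarrow> (P has_real_derivative p u) (at u within {0..1})" "P 1 = P 0"
  shows "periodic_integral p (newton_kernel j (Suc c)) =
    real (j + 2) * periodic_integral P (newton_kernel (j + 1) (Suc c))
    - real (Suc c) * periodic_integral P (newton_kernel (j + 2) c)"
proof -
  have cP: "continuous_on {0..1} P" using P(1) by (rule DERIV_continuous_on)
  define f where "f = (\<lambda>x. real (Suc c) * newton_kernel (j + 2) c x)"
  define g where "g = (\<lambda>x. (- real (j + 2)) * newton_kernel (j + 1) (Suc c) x)"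
  define C where "C = real (Suc c) * (fact (j + 2) / real (c + 1) ^ (j + 2))"
  define D where "D = real (j + 2) * (fact (j + 1) / real (Suc c + 1) ^ (j + 1))"
  have f: "continuous_on {1..} f" "\<And>x. x \<ge> 1 \<Longrightarrow> \<bar>f x\<bar> \<le> C / x ^ 2"
    unfolding f_def C_def abs_mult times_divide_eq_right[symmetric]
    using mult_left_mono[OF newton_kernel_bound[of _ "j + 2" c], of _ "real (Suc c)"]
    by (auto intro!: continuous_intros newton_kernel_continuous simp: mult.assoc)
  have g: "continuous_on {1..} g" "\<And>x. x \<ge> 1 \<Longrightarrow> \<bar>g x\<bar> \<le> D / x ^ 2"
    unfolding g_def D_def abs_mult abs_minus_cancel
    using mult_left_mono[OF newton_kernel_bound[of _ "j + 1" "Suc c"], of _ "real (j + 2)"]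
    by (auto intro!: continuous_intros newton_kernel_continuous simp: mult.assoc)
  have fg: "continuous_on {1..} (\<lambda>x. f x + g x)"
    "\<And>x. x \<ge> 1 \<Longrightarrow> \<bar>f x + g x\<bar> \<le> (C + D) / x ^ 2"
    using f g by (auto intro!: continuous_intros simp: add_divide_distrib intro: order_trans[OF abs_triangle_ineq] add_mono)
  have "periodic_integral p (newton_kernel j (Suc c)) = - periodic_integral P (\<lambda>x. f x + g x)"
  proof (rule periodic_integral_by_parts[OF p P _ fg newton_kernel_at_1 newton_kernel_tendsto_0])
    show "(newton_kernel j (Suc c) has_real_derivative f x + g x) (at x)" if "x \<ge> 1" for x
      using newton_kernel_deriv[OF that] by (simp only: f_def g_def mult_minus_left diff_conv_add_uminus)
  qed
  also have "\<dots> = - (periodic_integral P f + periodic_integral P g)"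
    by (simp only: periodic_integral_add[OF cP f g])
  also have "\<dots> = real (j + 2) * periodic_integral P (newton_kernel (j + 1) (Suc c))
    - real (Suc c) * periodic_integral P (newton_kernel (j + 2) c)"
  proof -
    have "periodic_integral P f = real (Suc c) * periodic_integral P (newton_kernel (j + 2) c)"
      unfolding f_def
      by (rule periodic_integral_cmult[OF cP newton_kernel_continuous newton_kernel_bound])
    moreover have "periodic_integral P g
        = - real (j + 2) * periodic_integral P (newton_kernel (j + 1) (Suc c))"
      unfolding g_def
      by (rule periodic_integral_cmult[OF cP newton_kernel_continuous newton_kernel_bound])
    ultimately show ?thesis by linarith
  qed
  finally show ?thesis .
qed

text \<open>\<open>K\<close> integrations by parts gain \<open>K\<close> powers of \<open>c\<close>;
  the shift \<open>c + K\<close> reserves one factor 1 - 1/x for each of them. Both \<open>p\<close>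
  and \<open>j\<close> change at every step, hence the generalised induction.\<close>

lemma periodic_integral_newton_kernel_decay:
  assumes p: "continuous_on {0..1} p" "integral {0..1} p = 0"
  shows "\<exists>C. \<forall>c. \<bar>periodic_integral p (newton_kernel j (c + K))\<bar> \<le> C / real (c + 1) ^ (j + K)"
  using p
proof (induction K arbitrary: p j)
  case 0
  have "bounded (p ` {0..1})"
    using 0(1) compact_continuous_image compact_imp_bounded by blast
  then obtain B where B: "\<And>u. u \<in> {0..1} \<Longrightarrow> \<bar>p u\<bar> \<le> B"
    unfolding bounded_iff by fastforce
  have "\<bar>periodic_integral p (newton_kernel j c)\<bar>
      \<le> (B * fact j * (pi\<^sup>2 / 6)) / real (c + 1) ^ j" for c
    using periodic_integral_bound[OF 0(1) B newton_kernel_continuous newton_kernel_bound]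
    by (simp add: mult_ac)
  then show ?case by (intro exI[of _ "B * fact j * (pi\<^sup>2 / 6)"]) simp
next
  case (Suc K)
  obtain P where cP: "continuous_on {0..1} P" "integral {0..1} P = 0" and P1: "P 1 = P 0"
    and P: "\<And>u. u \<in> {0..1} \<Longrightarrow> (P has_real_derivative p u) (at u within {0..1})"
    using mean_zero_antiderivative[OF Suc.prems] by blast
  obtain C1 where C1:
    "\<And>c. \<bar>periodic_integral P (newton_kernel (j + 1) (c + K))\<bar> \<le> C1 / real (c + 1) ^ (j + 1 + K)"
    using Suc.IH[OF cP] by blast
  obtain C2 where C2:
    "\<And>c. \<bar>periodic_integral P (newton_kernel (j + 2) (c + K))\<bar> \<le> C2 / real (c + 1) ^ (j + 2 + K)"
    using Suc.IH[OF cP] by blast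
  have C1_nonneg: "C1 \<ge> 0" using C1[of 0] by simp
  have C2_nonneg: "C2 \<ge> 0" using C2[of 0] by simp
  have "\<bar>periodic_integral p (newton_kernel j (c + Suc K))\<bar>
      \<le> (real (j + 2) * C1 + real (K + 1) * C2) / real (c + 1) ^ (j + Suc K)" for c
  proof -
    \<comment> \<open>The exponent \<open>Suc (c + K)\<close> is \<open>Suc c + K\<close>, so the
      induction hypothesis applies at \<open>Suc c\<close>; its denominator is then weakened to a
      power of c+1.\<close>
    have "\<bar>periodic_integral P (newton_kernel (j + 1) (Suc (c + K)))\<bar>
        \<le> C1 / real (Suc c + 1) ^ (j + 1 + K)"
      using C1[of "Suc c"] by simp
    also have "\<dots> \<le> C1 / real (c + 1) ^ (j + 1 + K)"
      using C1_nonneg by (intro divide_left_mono power_mono) auto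
    finally have 1: "real (j + 2) * \<bar>periodic_integral P (newton_kernel (j + 1) (Suc (c + K)))\<bar>
        \<le> real (j + 2) * (C1 / real (c + 1) ^ (j + Suc K))"
      by (intro mult_left_mono) auto
    \<comment> \<open>Here two powers are gained and one is spent: c+K+1 is at most
      (K+1)(c+1).\<close>
    have "real (Suc (c + K)) * \<bar>periodic_integral P (newton_kernel (j + 2) (c + K))\<bar>
        \<le> (real (K + 1) * real (c + 1)) * (C2 / real (c + 1) ^ (j + 2 + K))"
    proof (intro mult_mono C2)
      show "real (Suc (c + K)) \<le> real (K + 1) * real (c + 1)" by (simp add: algebra_simps)
    qed auto
    also have "\<dots> = real (K + 1) * C2 / real (c + 1) ^ (j + Suc K)"
      by (simp add: field_simps del: of_nat_Suc of_nat_add)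
    finally have 2: "real (Suc (c + K)) * \<bar>periodic_integral P (newton_kernel (j + 2) (c + K))\<bar>
      \<le> real (K + 1) * C2 / real (c + 1) ^ (j + Suc K)" .
    have "\<bar>periodic_integral p (newton_kernel j (Suc (c + K)))\<bar>
        \<le> real (j + 2) * \<bar>periodic_integral P (newton_kernel (j + 1) (Suc (c + K)))\<bar>
          + real (Suc (c + K)) * \<bar>periodic_integral P (newton_kernel (j + 2) (c + K))\<bar>"
    proof -
      define X where "X = periodic_integral P (newton_kernel (j + 1) (Suc (c + K)))"
      define Y where "Y = periodic_integral P (newton_kernel (j + 2) (c + K))"
      have "periodic_integral p (newton_kernel j (Suc (c + K)))
          = real (j + 2) * X - real (Suc (c + K)) * Y"
        unfolding X_def Y_def by (rule periodic_integral_newton_kernel_Suc[OF Suc.prems(1) P P1])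
      also have "\<bar>\<dots>\<bar> \<le> \<bar>real (j + 2) * X\<bar> + \<bar>real (Suc (c + K)) * Y\<bar>"
        by (rule abs_triangle_ineq4)
      finally show ?thesis unfolding X_def Y_def by (simp only: abs_mult abs_of_nat)
    qed
    then show ?thesis using 1 2 by (simp add: add_divide_distrib)
  qed
  then show ?case by blast
qed

section \<open>Trapezoidal Euler-Maclaurin summation\<close>

text \<open>The first Bernoulli polynomial, that is, the antiderivative of 1 with mean zero on
  [0,1].\<close>

definition sawtooth :: "real \<Rightarrow> real" where
  "sawtooth u = u - 1 / 2"

lemma sawtooth_continuous: "continuous_on S sawtooth"
  unfolding sawtooth_def[abs_def] by (intro continuous_intros)

lemma sawtooth_bound: "u \<in> {0..1} \<Longrightarrow> \<bar>sawtooth u\<bar> \<le> 1 / 2"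
  by (auto simp: sawtooth_def abs_if)

lemma sawtooth_deriv: "(sawtooth has_real_derivative 1) (at u within S)"
  unfolding sawtooth_def[abs_def] by (auto intro!: derivative_eq_intros)

lemma integral_sawtooth: "integral {0..1} sawtooth = 0"
proof -
  have "(sawtooth has_integral ((1 ^ 2 / 2 - 1 / 2) - (0 ^ 2 / 2 - 0 / 2))) {0..1}"
    by (rule fundamental_theorem_of_calculus[where f = "\<lambda>u. u ^ 2 / 2 - u / 2"])
      (auto simp: sawtooth_def has_real_derivative_iff_has_vector_derivative[symmetric]
        intro!: derivative_eq_intros)
  then show ?thesis by (simp add: integral_unique)
qed

text \<open>On each cell, integrating f against 1 with the sawtooth as antiderivative of 1 gives the
  trapezoidal rule, and the error is the cell integral of the sawtooth against f'. Summation over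
  the cells telescopes F.\<close>

lemma sum_minus_integral_tendsto:
  assumes F: "\<And>x. x \<ge> 1 \<Longrightarrow> (F has_real_derivative f x) (at x)"
    and f: "\<And>x. x \<ge> 1 \<Longrightarrow> (f has_real_derivative f' x) (at x)"
    and f': "continuous_on {1..} f'" "\<And>x. x \<ge> 1 \<Longrightarrow> \<bar>f' x\<bar> \<le> C / x ^ 2"
    and finf: "(\<lambda>m. f (real (Suc m))) \<longlonglongrightarrow> 0"
  shows "(\<lambda>M. (\<Sum>m<M. f (real (Suc m))) - F (real (Suc M)))
    \<longlonglongrightarrow> periodic_integral sawtooth f' + f 1 / 2 - F 1"
proof -
  have cf: "continuous_on {1..} f"
    by (intro continuous_at_imp_continuous_on ballI) (auto intro: DERIV_isCont f)
  \<comment> \<open>The integral of f over a cell is computed twice: here from F, with weight 0 and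
    antiderivative 1, and next with the sawtooth as antiderivative of 1.\<close>
  have "cell_integral (\<lambda>_. 1) f m = F (real (Suc (Suc m))) - F (real (Suc m))" for m
    using cell_integral_by_parts[of "\<lambda>_. 0" "\<lambda>_. 1" F f m] F cf
    by (auto simp: cell_integral_def)
  moreover have "cell_integral (\<lambda>_. 1) f m
      = sawtooth 1 * f (real (Suc (Suc m))) - sawtooth 0 * f (real (Suc m))
        - cell_integral sawtooth f' m" for m
    using f f'(1) by (intro cell_integral_by_parts sawtooth_deriv) auto
  ultimately have cell: "cell_integral sawtooth f' m
      = (f (real (Suc m)) + f (real (Suc (Suc m)))) / 2
        - (F (real (Suc (Suc m))) - F (real (Suc m)))" for m
    by (simp add: sawtooth_def field_simps)
  \<comment> \<open>The sum ends at f(M) while the trapezoids reach M+1; this leaves half of f(M+1),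
    which vanishes in the limit.\<close>
  have "(\<Sum>m<M. f (real (Suc m))) - F (real (Suc M))
      = (\<Sum>m<M. cell_integral sawtooth f' m) + f 1 / 2 - F 1 - f (real (Suc M)) / 2" for M
    by (induction M) (auto simp: cell field_simps)
  moreover have "(\<lambda>M. (\<Sum>m<M. cell_integral sawtooth f' m) + f 1 / 2 - F 1 - f (real (Suc M)) / 2)
      \<longlonglongrightarrow> periodic_integral sawtooth f' + f 1 / 2 - F 1 - 0 / 2"
    using periodic_integral_sums[OF sawtooth_continuous f']
    by (intro tendsto_intros finf) (auto simp: sums_def)
  ultimately show ?thesis by simp
qed

text \<open>Summation of 1/x with primitive ln: the limit of the harmonic sum minus the logarithm is
  gamma. This fixes b_1 and hence the value of the Newton series at 1.\<close>

lemma periodic_integral_inverse_square: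
  "periodic_integral sawtooth (newton_kernel 0 0) = 1 / 2 - euler_mascheroni"
proof -
  define f' where "f' = (\<lambda>x. (- 1) * newton_kernel 0 0 x)"
  have b: "\<bar>newton_kernel 0 0 x\<bar> \<le> 1 / x ^ 2" if "x \<ge> 1" for x
    using newton_kernel_bound[OF that, of 0 0] by simp
  have "(\<lambda>M. (\<Sum>m<M. 1 / real (Suc m)) - ln (real (Suc M)))
    \<longlonglongrightarrow> periodic_integral sawtooth f' + (1 / 1) / 2 - ln 1"
  proof (rule sum_minus_integral_tendsto)
    show "((\<lambda>x. 1 / x) has_real_derivative f' x) (at x)" if "x \<ge> 1" for x
      using that unfolding f'_def newton_kernel_def
      by (auto intro!: derivative_eq_intros simp: power2_eq_square)
    show "(ln has_real_derivative 1 / x) (at x)" if "x \<ge> 1" for x :: real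
      using that by (auto intro!: derivative_eq_intros)
    show "continuous_on {1..} f'"
      unfolding f'_def by (intro continuous_intros newton_kernel_continuous)
    show "\<bar>f' x\<bar> \<le> 1 / x ^ 2" if "x \<ge> 1" for x
      using b[OF that] by (simp add: f'_def)
    show "(\<lambda>m. 1 / real (Suc m)) \<longlonglongrightarrow> 0"
      using LIMSEQ_inverse_real_of_nat by (simp only: inverse_eq_divide)
  qed
  moreover have "(\<lambda>M. (\<Sum>m<M. 1 / real (Suc m)) - ln (real (Suc M))) \<longlonglongrightarrow> euler_mascheroni"
  proof -
    \<comment> \<open>The sum has \<open>M\<close> terms but the logarithm is taken at M+1, so the
      last harmonic term, which tends to 0, is removed.\<close>
    have "(\<lambda>M. (harm (Suc M) - ln (real (Suc M))) - 1 / real (Suc M)) \<longlonglongrightarrow> euler_mascheroni - 0"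
      using LIMSEQ_Suc[OF euler_mascheroni_LIMSEQ] LIMSEQ_inverse_real_of_nat
      by (intro tendsto_diff) (simp_all only: inverse_eq_divide)
    moreover have "harm (Suc M) = (\<Sum>m<M. 1 / real (Suc m)) + 1 / real (Suc M)" for M
      by (induction M) (auto simp: harm_Suc harm_def inverse_eq_divide)
    ultimately show ?thesis by (simp add: algebra_simps)
  qed
  ultimately have "periodic_integral sawtooth f' + (1 / 1) / 2 - ln 1 = euler_mascheroni"
    by (rule LIMSEQ_unique)
  moreover have "periodic_integral sawtooth f' = (- 1) * periodic_integral sawtooth (newton_kernel 0 0)"
    unfolding f'_def
    by (rule periodic_integral_cmult[OF sawtooth_continuous newton_kernel_continuous b])
  ultimately show ?thesis by simp
qed

lemma powr_le_inverse_square: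
  fixes x t :: real
  assumes "x \<ge> 1" "t \<ge> 0"
  shows "\<bar>x powr (- t - 2)\<bar> \<le> 1 / x ^ 2"
proof -
  have "x powr (- t - 2) \<le> x powr (- 2)" using assms by (intro powr_mono) auto
  also have "\<dots> = 1 / x ^ 2" using assms by (simp add: powr_minus_divide)
  finally show ?thesis by simp
qed

lemma powr_continuous: "continuous_on {1..} (\<lambda>x :: real. x powr a)"
  by (intro continuous_intros) auto

text \<open>Euler-Maclaurin for x^(-s) with primitive x^(1-s)/(1-s), whose value at 1 supplies the
  pole term. The exponent -s-1 is written as -(s-1)-2 to match the binomial expansion with t =
  s-1.\<close>

lemma zeta_sums_real:
  fixes s :: real
  assumes s: "s > 1"
  shows "(\<lambda>m. real (Suc m) powr - s) sums
    (1 / 2 - s * periodic_integral sawtooth (\<lambda>x. x powr (- (s - 1) - 2)) + 1 / (s - 1))"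
proof -
  define f' where "f' = (\<lambda>x :: real. (- s) * x powr (- (s - 1) - 2))"
  note b = powr_le_inverse_square[of _ "s - 1"]
  have inf: "(\<lambda>m. real (Suc m) powr - a) \<longlonglongrightarrow> 0" if "a > 0" for a
    using that
    by (intro tendsto_neg_powr filterlim_compose[OF filterlim_real_sequentially filterlim_Suc]) auto
  have "(\<lambda>M. (\<Sum>m<M. real (Suc m) powr - s) - real (Suc M) powr (1 - s) / (1 - s))
      \<longlonglongrightarrow> periodic_integral sawtooth f' + 1 powr - s / 2 - 1 powr (1 - s) / (1 - s)"
  proof (rule sum_minus_integral_tendsto)
    show "((\<lambda>x. x powr (1 - s) / (1 - s)) has_real_derivative x powr - s) (at x)" if "x \<ge> 1" for x
      using DERIV_cdivide[OF has_real_derivative_powr[of x "1 - s"], of "1 - s"] that s by simp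
    show "((\<lambda>x. x powr - s) has_real_derivative f' x) (at x)" if "x \<ge> 1" for x
    proof -
      have eq: "- (s - 1) - 2 = - s - 1" by simp
      show ?thesis
        unfolding f'_def eq using that by (intro has_real_derivative_powr) auto
    qed
    show "continuous_on {1..} f'"
      unfolding f'_def by (intro continuous_on_mult continuous_on_const powr_continuous)
    show "\<bar>f' x\<bar> \<le> s / x ^ 2" if "x \<ge> 1" for x
    proof -
      have "s * \<bar>x powr (- (s - 1) - 2)\<bar> \<le> s * (1 / x ^ 2)"
        using that s by (intro mult_left_mono b) auto
      then show ?thesis using s by (simp only: f'_def abs_mult) simp
    qed
    show "(\<lambda>m. real (Suc m) powr - s) \<longlonglongrightarrow> 0" using s by (intro inf) auto
  qed
  \<comment> \<open>For s > 1 the primitive vanishes at infinity, so adding it back leaves the limit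
    of the plain partial sums.\<close>
  moreover have "(\<lambda>M. real (Suc M) powr (1 - s) / (1 - s)) \<longlonglongrightarrow> 0 / (1 - s)"
    using inf[of "s - 1"] s by (intro tendsto_divide[OF _ tendsto_const]) simp_all
  ultimately have lim: "(\<lambda>M. ((\<Sum>m<M. real (Suc m) powr - s) - real (Suc M) powr (1 - s) / (1 - s))
      + real (Suc M) powr (1 - s) / (1 - s))
      \<longlonglongrightarrow> (periodic_integral sawtooth f' + 1 powr - s / 2 - 1 powr (1 - s) / (1 - s)) + 0 / (1 - s)"
    by (rule tendsto_add)
  have "periodic_integral sawtooth f'
      = (- s) * periodic_integral sawtooth (\<lambda>x. x powr (- (s - 1) - 2))"
    unfolding f'_def
    by (rule periodic_integral_cmult[OF sawtooth_continuous powr_continuous b]) (use s in auto)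
  moreover have "1 / (1 - s) = - (1 / (s - 1))" using s by (simp add: field_simps)
  ultimately have "(periodic_integral sawtooth f' + 1 powr - s / 2 - 1 powr (1 - s) / (1 - s)) + 0 / (1 - s)
      = 1 / 2 - s * periodic_integral sawtooth (\<lambda>x. x powr (- (s - 1) - 2)) + 1 / (s - 1)"
    by (simp only: powr_one_eq_one div_0)
  then show ?thesis
    unfolding sums_def using lim by (simp only: diff_add_cancel)
qed

section \<open>Binomial series under the integral\<close>

lemma gbinomial_Suc_eq:
  fixes a :: "'a :: field_char_0"
  shows "a gchoose Suc n = (a gchoose n) * (a - of_nat n) / of_nat (Suc n)"
proof -
  have "of_nat (Suc n) * (a gchoose Suc n) = (a gchoose n) * (a - of_nat n)"
    using gbinomial_mult_1[of a n] by (simp add: algebra_simps)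
  then show ?thesis by (simp add: nonzero_eq_divide_eq mult.commute del: of_nat_Suc)
qed

(* For 0 < t < 1 all terms after the first have the same sign, so the bounded partial sums
   give absolute convergence. *)
lemma summable_abs_gbinomial:
  fixes t :: real
  assumes t: "0 < t" "t < 1"
  shows "summable (\<lambda>n. \<bar>t gchoose n\<bar>)"
proof -
  define a where "a = (\<lambda>n. (-1) ^ n * (t gchoose n))"
  have a_Suc: "a (Suc n) = a n * ((real n - t) / real (Suc n))" for n
    by (simp add: a_def gbinomial_Suc_eq field_simps del: of_nat_Suc)
  have neg: "a (Suc n) \<le> 0" for n
  proof (induction n)
    case 0
    then show ?case using t by (simp add: a_def)
  next
    case (Suc n)
    then show ?case
      unfolding a_Suc[of "Suc n"] using t by (intro mult_nonpos_nonneg) auto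
  qed
  \<comment> \<open>Up to sign, binom(t-1, m) is the partial sum up to \<open>m\<close> of the
    alternating coefficients of t; its sign therefore bounds those partial sums below by 0.\<close>
  have nonneg: "(-1) ^ m * ((t - 1) gchoose m) \<ge> 0" for m
  proof (induction m)
    case (Suc m)
    have "(-1) ^ Suc m * ((t - 1) gchoose Suc m)
        = ((-1) ^ m * ((t - 1) gchoose m)) * ((real (Suc m) - t) / real (Suc m))"
      by (simp add: gbinomial_Suc_eq field_simps)
    also have "\<dots> \<ge> 0" using Suc t by (intro mult_nonneg_nonneg[OF Suc]) auto
    finally show ?case .
  qed auto
  have "summable (\<lambda>n. - a (Suc n))"
  proof (rule summableI_nonneg_bounded)
    show "(\<Sum>k<n. - a (Suc k)) \<le> 1" for n
    proof -
      have "0 \<le> (\<Sum>k\<le>n. a k)"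
        using nonneg[of n] gbinomial_sum_lower_neg[of t n] by (simp add: a_def mult.commute)
      also have "\<dots> = 1 + (\<Sum>k<n. a (Suc k))"
        by (subst sum.atMost_shift) (simp add: a_def)
      finally show ?thesis by (simp add: sum_negf)
    qed
  qed (use neg in auto)
  moreover have "- a (Suc n) = \<bar>t gchoose Suc n\<bar>" for n
  proof -
    have "- a (Suc n) = \<bar>a (Suc n)\<bar>" using neg[of n] by simp
    then show ?thesis by (simp add: a_def abs_mult)
  qed
  ultimately have "summable (\<lambda>n. \<bar>t gchoose Suc n\<bar>)" by (simp only:)
  then show ?thesis by (rule summable_Suc_iff[THEN iffD1])
qed

text \<open>Expand x^(-t) = (1 - (1 - 1/x))^t and integrate termwise. As 1 - 1/x approaches 1,
  uniformity comes from absolute summability of the coefficients: the remainder is at most their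
  tail times 1/x^2.\<close>

lemma periodic_integral_powr_sums:
  fixes t :: real
  assumes t: "0 < t" "t < 1"
  shows "(\<lambda>n. (-1) ^ n * (t gchoose n) * periodic_integral sawtooth (newton_kernel 0 n))
    sums periodic_integral sawtooth (\<lambda>x. x powr (- t - 2))"
proof -
  define g where "g = (\<lambda>x :: real. x powr (- t - 2))"
  define a where "a = (\<lambda>n. (-1) ^ n * (t gchoose n))"
  define S where "S = (\<lambda>N x. \<Sum>n<N. a n * newton_kernel 0 n x)"
  define r where "r = (\<lambda>N. \<Sum>n. \<bar>a (n + N)\<bar>)"
  have sa: "summable (\<lambda>n. \<bar>a n\<bar>)"
    using summable_abs_gbinomial[OF t] by (simp add: a_def abs_mult)
  have kb: "\<bar>newton_kernel 0 n x\<bar> \<le> 1 / x ^ 2" if "x \<ge> 1" for n x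
    using newton_kernel_bound[OF that, of 0 n] by simp
  have akb: "\<bar>a n * newton_kernel 0 n x\<bar> \<le> \<bar>a n\<bar> / x ^ 2" if "x \<ge> 1" for n x
    using mult_left_mono[OF kb[OF that], of "\<bar>a n\<bar>" n] by (simp add: abs_mult)
  have cS: "continuous_on {1..} (S N)" for N
    unfolding S_def by (intro continuous_intros newton_kernel_continuous)
  have S_bound: "\<bar>S N x\<bar> \<le> (\<Sum>n<N. \<bar>a n\<bar>) / x ^ 2" if "x \<ge> 1" for N x
    unfolding S_def sum_divide_distrib
    by (rule order_trans[OF sum_abs]) (intro sum_mono akb that)
  have cg: "continuous_on {1..} g"
    unfolding g_def by (rule powr_continuous)
  \<comment> \<open>The binomial series is evaluated at -(1 - 1/x), inside the unit disc for each x,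
    and multiplied by 1/x^2.\<close>
  have g_sums: "(\<lambda>n. a n * newton_kernel 0 n x) sums g x" if x: "x \<ge> 1" for x
  proof -
    have "\<bar>- (1 - 1 / x)\<bar> < 1" using x by (simp add: field_simps)
    then have "(\<lambda>n. (t gchoose n) * (- (1 - 1 / x)) ^ n) sums (1 + - (1 - 1 / x)) powr t"
      by (rule gen_binomial_real)
    from sums_mult[OF this, of "(1 / x) ^ 2"]
    have "(\<lambda>n. (1 / x) ^ 2 * ((t gchoose n) * (- (1 - 1 / x)) ^ n)) sums ((1 / x) ^ 2 * (1 / x) powr t)"
      by simp
    moreover have "(1 / x) ^ 2 * (1 / x) powr t = g x"
    proof -
      have "(1 / x) ^ 2 = x powr (- 2)" using x by (simp add: powr_minus_divide power_divide)
      moreover have "(1 / x) powr t = x powr (- t)" using x by (simp add: powr_divide powr_minus_divide)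
      ultimately show ?thesis unfolding g_def by (simp only: flip: powr_add) (simp add: algebra_simps)
    qed
    moreover have "(1 / x) ^ 2 * ((t gchoose n) * (- (1 - 1 / x)) ^ n) = a n * newton_kernel 0 n x" for n
      unfolding a_def newton_kernel_def power_minus[of "1 - 1 / x"] by (simp only: add_0 mult_ac)
    ultimately show ?thesis by (simp only:)
  qed
  have tail: "\<bar>g x - S N x\<bar> \<le> r N / x ^ 2" if x: "x \<ge> 1" for N x
  proof -
    have "(\<lambda>n. a (n + N) * newton_kernel 0 (n + N) x) sums (g x - S N x)"
      using g_sums[OF x] unfolding S_def by (subst sums_iff_shift) simp
    then have "g x - S N x = (\<Sum>n. a (n + N) * newton_kernel 0 (n + N) x)"
      by (rule sums_unique)
    also have "norm \<dots> \<le> (\<Sum>n. \<bar>a (n + N)\<bar> / x ^ 2)"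
      by (intro norm_suminf_le summable_divide summable_ignore_initial_segment sa)
        (use akb[OF x] in auto)
    also have "\<dots> = r N / x ^ 2"
      unfolding r_def by (intro suminf_divide summable_ignore_initial_segment sa)
    finally show ?thesis by simp
  qed
  have PS: "periodic_integral sawtooth (S N)
      = (\<Sum>n<N. a n * periodic_integral sawtooth (newton_kernel 0 n))" for N
  proof (induction N)
    case 0
    then show ?case by (simp add: S_def periodic_integral_def cell_integral_def)
  next
    case (Suc N)
    have "periodic_integral sawtooth (S (Suc N))
        = periodic_integral sawtooth (\<lambda>x. S N x + a N * newton_kernel 0 N x)"
      by (simp add: S_def)
    also have "\<dots> = periodic_integral sawtooth (S N)
        + periodic_integral sawtooth (\<lambda>x. a N * newton_kernel 0 N x)"
      by (rule periodic_integral_add[OF sawtooth_continuous cS S_bound _ akb])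
        (auto intro: continuous_intros newton_kernel_continuous)
    also have "periodic_integral sawtooth (\<lambda>x. a N * newton_kernel 0 N x)
        = a N * periodic_integral sawtooth (newton_kernel 0 N)"
      by (rule periodic_integral_cmult[OF sawtooth_continuous newton_kernel_continuous kb])
    finally show ?case using Suc by simp
  qed
  have bound: "norm (periodic_integral sawtooth g - periodic_integral sawtooth (S N)) \<le> 1 / 2 * r N * (pi\<^sup>2 / 6)" for N
  proof -
    have cR: "continuous_on {1..} (\<lambda>x. g x - S N x)" by (intro continuous_intros cg cS)
    have "periodic_integral sawtooth g = periodic_integral sawtooth (\<lambda>x. S N x + (g x - S N x))"
      by simp
    also have "\<dots> = periodic_integral sawtooth (S N) + periodic_integral sawtooth (\<lambda>x. g x - S N x)"
      by (rule periodic_integral_add[OF sawtooth_continuous cS S_bound cR tail])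
    finally show ?thesis
      using periodic_integral_bound[OF sawtooth_continuous sawtooth_bound cR tail] by simp
  qed
  have "(\<lambda>N. 1 / 2 * r N * (pi\<^sup>2 / 6)) \<longlonglongrightarrow> 1 / 2 * 0 * (pi\<^sup>2 / 6)"
    unfolding r_def by (intro tendsto_intros suminf_exist_split2 sa)
  then have "(\<lambda>N. 1 / 2 * r N * (pi\<^sup>2 / 6)) \<longlonglongrightarrow> 0" by simp
  with always_eventually[OF allI[OF bound]]
  have "(\<lambda>N. periodic_integral sawtooth g - periodic_integral sawtooth (S N)) \<longlonglongrightarrow> 0"
    by (rule Lim_null_comparison)
  from tendsto_diff[OF tendsto_const this, of "periodic_integral sawtooth g"]
  show ?thesis by (simp add: PS sums_def a_def g_def)
qed

section \<open>The entire Newton series\<close>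

text \<open>The value 1/2 at 0 is Z(0); the general formula would give 0 there because of the factor
  \<open>n\<close>.\<close>

definition newton_b :: "nat \<Rightarrow> real" where
  "newton_b n = (if n = 0 then 1 / 2 else real n * periodic_integral sawtooth (newton_kernel 0 (n - 1)))"

text \<open>The factor \<open>n\<close> costs one power, so the kernel estimate is used with K+1
  integrations by parts. It covers only n \<ge> K+2; the finitely many earlier terms are absorbed by
  boundedness of the shifted sequence.\<close>

lemma newton_b_decay: "\<exists>C. \<forall>n. \<bar>newton_b n\<bar> \<le> C / real (Suc n) ^ K"
proof -
  obtain C where C: "\<And>c. \<bar>periodic_integral sawtooth (newton_kernel 0 (c + (K + 1)))\<bar>
      \<le> C / real (c + 1) ^ (0 + (K + 1))"
    using periodic_integral_newton_kernel_decay[OF sawtooth_continuous integral_sawtooth] by blast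
  define X where "X = (\<lambda>n. newton_b n * real (Suc n) ^ K)"
  have C_nonneg: "C \<ge> 0" using C[of 0] by simp
  have bound: "norm (X (c + (K + 2))) \<le> real (K + 3) ^ (K + 1) * C" for c
  proof -
    \<comment> \<open>This is where K+3 comes from: c+K+3 is at most (K+3)(c+1).\<close>
    have le: "real (c + (K + 2)) \<le> real (K + 3) * real (c + 1)"
      "real (Suc (c + (K + 2))) \<le> real (K + 3) * real (c + 1)"
      by (simp_all add: algebra_simps)
    have "norm (X (c + (K + 2)))
        = real (c + (K + 2)) * \<bar>periodic_integral sawtooth (newton_kernel 0 (c + (K + 1)))\<bar>
          * real (Suc (c + (K + 2))) ^ K"
      by (simp add: X_def newton_b_def abs_mult del: of_nat_Suc)
    also have "\<dots> \<le> (real (K + 3) * real (c + 1)) * (C / real (c + 1) ^ (0 + (K + 1)))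
        * (real (K + 3) * real (c + 1)) ^ K"
      using C_nonneg by (intro mult_mono le C power_mono) auto
    also have "\<dots> = real (K + 3) ^ (K + 1) * C"
      by (simp add: power_mult_distrib field_simps del: of_nat_Suc of_nat_add)
    finally show ?thesis .
  qed
  have "Bseq (\<lambda>c. X (c + (K + 2)))"
    using bound by (rule BseqI')
  then have "Bseq X" by (rule Bseq_offset)
  then obtain D where D: "\<And>n. norm (X n) \<le> D" by (auto simp: Bseq_def)
  have "\<bar>newton_b n\<bar> \<le> D / real (Suc n) ^ K" for n
    using D[of n] by (simp add: X_def abs_mult pos_le_divide_eq)
  then show ?thesis by blast
qed

text \<open>Successive binomials differ by a factor of norm at most 1 + N/(n+1), which Bernoulli's
  inequality bounds by ((n+2)/(n+1))^N; the product telescopes. The growth is thus polynomial in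
  \<open>n\<close>, uniformly on a disc.\<close>

lemma norm_gbinomial_le:
  fixes s :: complex
  assumes s: "norm s \<le> real N"
  shows "norm (s gchoose n) \<le> real (Suc n) ^ N"
proof (induction n)
  case (Suc n)
  have "norm (s - of_nat n) \<le> real N + real n"
    using norm_triangle_ineq4[of s "of_nat n"] s by simp
  then have "norm (s gchoose Suc n) \<le> real (Suc n) ^ N * (real N + real n) / real (Suc n)"
    unfolding gbinomial_Suc_eq norm_divide norm_mult norm_of_nat
    by (intro divide_right_mono mult_mono Suc) auto
  also have "\<dots> \<le> real (Suc n) ^ N * (1 + 1 / real (Suc n)) ^ N"
  proof -
    have "(real N + real n) / real (Suc n) \<le> 1 + real N * (1 / real (Suc n))"
      by (simp add: field_simps)
    also have "\<dots> \<le> (1 + 1 / real (Suc n)) ^ N"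
      by (rule Bernoulli_inequality) (rule order_trans[of _ 0], auto)
    finally show ?thesis
      unfolding times_divide_eq_right[symmetric] by (intro mult_left_mono) auto
  qed
  also have "\<dots> = real (Suc (Suc n)) ^ N"
  proof -
    have "real (Suc n) * (1 + 1 / real (Suc n)) = real (Suc (Suc n))" by (simp add: field_simps)
    then show ?thesis unfolding power_mult_distrib[symmetric] by (rule arg_cong)
  qed
  finally show ?case .
qed auto

definition newton_term :: "nat \<Rightarrow> complex \<Rightarrow> complex" where
  "newton_term n s = (-1) ^ n * of_real (newton_b n) * (s gchoose n)"

definition newton_series :: "complex \<Rightarrow> complex" where
  "newton_series s = (\<Sum>n. newton_term n s)"

text \<open>Decay of order N+2 against growth of order N leaves an inverse square, with one constant
  for the whole disc. This serves both pointwise convergence and the Weierstrass M-test.\<close>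

lemma newton_term_bound:
  obtains C where "\<And>n s. norm s \<le> real N \<Longrightarrow> norm (newton_term n s) \<le> C * (1 / real (Suc n) ^ 2)"
proof -
  obtain C where C: "\<And>n. \<bar>newton_b n\<bar> \<le> C / real (Suc n) ^ (N + 2)"
    using newton_b_decay by blast
  have "norm (newton_term n s) \<le> C * (1 / real (Suc n) ^ 2)" if "norm s \<le> real N" for n s
  proof -
    have "norm (newton_term n s) = \<bar>newton_b n\<bar> * norm (s gchoose n)"
      by (simp add: newton_term_def norm_mult norm_power)
    also have "\<dots> \<le> C / real (Suc n) ^ (N + 2) * real (Suc n) ^ N"
      using order_trans[OF abs_ge_zero C] by (intro mult_mono C norm_gbinomial_le that) auto
    also have "\<dots> = C * (1 / real (Suc n) ^ 2)"
      by (simp add: power_add power2_eq_square del: of_nat_Suc)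
    finally show ?thesis .
  qed
  then show ?thesis using that by blast
qed

lemma newton_series_sums: "(\<lambda>n. newton_term n s) sums newton_series s"
proof -
  obtain N where N: "norm s \<le> real N" using real_arch_simple by blast
  obtain C where C: "\<And>n s. norm s \<le> real N \<Longrightarrow> norm (newton_term n s) \<le> C * (1 / real (Suc n) ^ 2)"
    using newton_term_bound[of N] by blast
  have "summable (\<lambda>n. newton_term n s)"
    by (rule summable_comparison_test'[OF summable_mult[OF sums_summable[OF inverse_squares_Suc_sums]]])
      (rule C[OF N])
  then show ?thesis unfolding newton_series_def by (rule summable_sums)
qed

lemma newton_series_holomorphic: "newton_series holomorphic_on UNIV"
proof (rule holomorphic_uniform_sequence)
  show "(\<lambda>s. \<Sum>n<M. newton_term n s) holomorphic_on UNIV" for M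
    unfolding newton_term_def gbinomial_prod_rev by (intro holomorphic_intros) auto
  fix x :: complex
  obtain N where N: "norm x + 1 \<le> real N" using real_arch_simple by blast
  obtain C where C: "\<And>n s. norm s \<le> real N \<Longrightarrow> norm (newton_term n s) \<le> C * (1 / real (Suc n) ^ 2)"
    using newton_term_bound[of N] by blast
  have "uniform_limit (cball x 1) (\<lambda>M s. \<Sum>n<M. newton_term n s) newton_series sequentially"
    unfolding newton_series_def[abs_def]
  proof (rule Weierstrass_m_test)
    show "summable (\<lambda>n. C * (1 / real (Suc n) ^ 2))"
      by (intro summable_mult sums_summable[OF inverse_squares_Suc_sums])
    fix n s assume "s \<in> cball x 1"
    then have "norm s \<le> real N"
      using N norm_triangle_sub[of s x] by (simp add: dist_norm norm_minus_commute)
    then show "norm (newton_term n s) \<le> C * (1 / real (Suc n) ^ 2)" by (rule C)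
  qed
  then show "\<exists>d>0. cball x d \<subseteq> UNIV \<and>
      uniform_limit (cball x d) (\<lambda>M s. \<Sum>n<M. newton_term n s) newton_series sequentially"
    by (intro exI[of _ 1]) auto
qed auto

text \<open>The binomials vanish for n > k, so the series terminates. These values are the input of
  the binomial inversion.\<close>

lemma newton_series_of_nat:
  "newton_series (of_nat k) = (\<Sum>n\<le>k. (-1) ^ n * of_real (newton_b n) * of_nat (k choose n))"
proof -
  have "(\<lambda>n. newton_term n (of_nat k)) sums (\<Sum>n\<le>k. newton_term n (of_nat k))"
    by (rule sums_finite) (auto simp: newton_term_def binomial_gbinomial[symmetric])
  then show ?thesis
    using newton_series_sums[of "of_nat k"] sums_unique2
    by (fastforce simp: newton_term_def binomial_gbinomial)
qed

lemma newton_series_1: "newton_series 1 = euler_mascheroni"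
proof -
  have "newton_series 1 = of_real (newton_b 0 - newton_b 1)"
    using newton_series_of_nat[of 1] by simp
  also have "newton_b 0 - newton_b 1 = euler_mascheroni"
    using periodic_integral_inverse_square by (simp add: newton_b_def)
  finally show ?thesis by simp
qed

lemma of_real_gbinomial: "(of_real (a gchoose n) :: complex) = of_real a gchoose n"
  by (simp add: gbinomial_prod_rev)

text \<open>Absorption, n binom(s, n) = s binom(s-1, n-1), turns the factor \<open>n\<close> of b_n
  into s and shifts the index, leaving the binomial series with t = s-1. The range 1 < s < 2 is 0 <
  t < 1.\<close>

lemma newton_series_of_real:
  fixes s :: real
  assumes s: "1 < s" "s < 2"
  shows "newton_series (of_real s)
    = of_real (1 / 2 - s * periodic_integral sawtooth (\<lambda>x. x powr (- (s - 1) - 2)))"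
proof -
  define q where "q = (\<lambda>n. periodic_integral sawtooth (newton_kernel 0 n))"
  define t where "t = (\<lambda>n. (-1) ^ n * newton_b n * (s gchoose n))"
  have "(\<lambda>n. (- s) * ((-1) ^ n * ((s - 1) gchoose n) * q n)) sums
      ((- s) * periodic_integral sawtooth (\<lambda>x. x powr (- (s - 1) - 2)))"
    unfolding q_def using s by (intro sums_mult periodic_integral_powr_sums) auto
  moreover have "t (Suc n) = (- s) * ((-1) ^ n * ((s - 1) gchoose n) * q n)" for n
  proof -
    have "t (Suc n) = - ((-1) ^ n * q n) * (real (Suc n) * (s gchoose Suc n))"
      by (simp add: t_def newton_b_def q_def del: of_nat_Suc)
    then show ?thesis unfolding gbinomial_absorption by simp
  qed
  ultimately have "(\<lambda>n. t (Suc n)) sums ((- s) * periodic_integral sawtooth (\<lambda>x. x powr (- (s - 1) - 2)))"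
    by (simp only:)
  then have "t sums ((- s) * periodic_integral sawtooth (\<lambda>x. x powr (- (s - 1) - 2)) + t 0)"
    by (rule sums_Suc)
  then have "(\<lambda>n. of_real (t n) :: complex) sums
      of_real ((- s) * periodic_integral sawtooth (\<lambda>x. x powr (- (s - 1) - 2)) + t 0)"
    by (rule sums_of_real)
  moreover have "of_real (t n) = newton_term n (of_real s)" for n
    by (simp add: t_def newton_term_def of_real_gbinomial)
  moreover have "(- s) * periodic_integral sawtooth (\<lambda>x. x powr (- (s - 1) - 2)) + t 0
      = 1 / 2 - s * periodic_integral sawtooth (\<lambda>x. x powr (- (s - 1) - 2))"
    by (simp add: t_def newton_b_def)
  ultimately show ?thesis
    using newton_series_sums[of "of_real s"] by (simp only: sums_unique2)
qed

section \<open>Dirichlet series and analytic continuation\<close>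

lemma dirichlet_term_norm:
  "norm (1 / of_nat (Suc n) powr s :: complex) = real (Suc n) powr - Re s"
  by (simp add: norm_divide norm_powr_real_powr powr_minus_divide del: of_nat_Suc)

lemma dirichlet_summable_bound: "a > 1 \<Longrightarrow> summable (\<lambda>n. real (Suc n) powr - a)"
  using zeta_sums_real by (rule sums_summable)

definition dirichlet_zeta :: "complex \<Rightarrow> complex" where
  "dirichlet_zeta s = (\<Sum>n. 1 / of_nat (Suc n) powr s)"

lemma dirichlet_zeta_sums:
  assumes "Re s > 1"
  shows "(\<lambda>n. 1 / of_nat (Suc n) powr s) sums dirichlet_zeta s"
proof -
  have "summable (\<lambda>n. norm (1 / of_nat (Suc n) powr s :: complex))"
    unfolding dirichlet_term_norm by (rule dirichlet_summable_bound[OF assms])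
  then show ?thesis
    unfolding dirichlet_zeta_def by (rule summable_sums[OF summable_norm_cancel])
qed

lemma dirichlet_zeta_holomorphic: "dirichlet_zeta holomorphic_on {s. Re s > 1}"
proof (rule holomorphic_uniform_sequence)
  show "open {s. Re s > 1}" by (rule open_halfspace_Re_gt)
  show "(\<lambda>s. \<Sum>n<M. 1 / of_nat (Suc n) powr s) holomorphic_on {s. Re s > 1}" for M
    by (intro holomorphic_intros) (auto simp del: of_nat_Suc)
  fix x :: complex assume "x \<in> {s. Re s > 1}"
  \<comment> \<open>Half the distance to the line Re s = 1, so the closed disc of this radius keeps
    the real part at least 1+d.\<close>
  define d where "d = (Re x - 1) / 2"
  have d: "d > 0" using \<open>x \<in> _\<close> by (simp add: d_def)
  have re: "Re s \<ge> 1 + d" if "s \<in> cball x d" for s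
  proof -
    have "Re x - Re s \<le> d"
      using that abs_Re_le_cmod[of "x - s"] by (simp add: dist_norm)
    then show ?thesis unfolding d_def by (simp add: field_simps)
  qed
  have "uniform_limit (cball x d) (\<lambda>M s. \<Sum>n<M. 1 / of_nat (Suc n) powr s) dirichlet_zeta sequentially"
    unfolding dirichlet_zeta_def[abs_def]
  proof (rule Weierstrass_m_test)
    show "summable (\<lambda>n. real (Suc n) powr - (1 + d))"
      using d by (intro dirichlet_summable_bound) auto
    show "norm (1 / of_nat (Suc n) powr s :: complex) \<le> real (Suc n) powr - (1 + d)"
      if "s \<in> cball x d" for n s
      unfolding dirichlet_term_norm using re[OF that] by (intro powr_mono) auto
  qed
  moreover have "cball x d \<subseteq> {s. Re s > 1}" using re d by force
  ultimately show "\<exists>d>0. cball x d \<subseteq> {s. Re s > 1} \<and>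
      uniform_limit (cball x d) (\<lambda>M s. \<Sum>n<M. 1 / of_nat (Suc n) powr s) dirichlet_zeta sequentially"
    using d by blast
qed

lemma dirichlet_zeta_of_real:
  assumes s: "s > 1"
  shows "dirichlet_zeta (of_real s)
    = of_real (1 / 2 - s * periodic_integral sawtooth (\<lambda>x. x powr (- (s - 1) - 2)) + 1 / (s - 1))"
proof -
  have "1 / of_nat (Suc n) powr (of_real s) = (of_real (real (Suc n) powr - s) :: complex)" for n
  proof -
    have "(of_nat (Suc n) :: complex) powr (of_real s) = of_real (real (Suc n) powr s)"
      using powr_of_real[of "real (Suc n)" s] by (simp del: of_nat_Suc)
    then show ?thesis by (simp add: powr_minus_divide del: of_nat_Suc)
  qed
  then show ?thesis
    using dirichlet_zeta_sums[of "of_real s"] sums_of_real[OF zeta_sums_real[OF s]] s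
    by (auto dest: sums_unique2)
qed

text \<open>Identity theorem on the half-plane: both sides are holomorphic there and have the same
  Euler-Maclaurin expression on the real segment (1,2), which accumulates at 3/2.\<close>

lemma newton_series_eq_dirichlet_zeta:
  assumes "Re s > 1"
  shows "newton_series s + 1 / (s - 1) = dirichlet_zeta s"
proof -
  define f where "f = (\<lambda>s. newton_series s + 1 / (s - 1) - dirichlet_zeta s)"
  have "f s = 0"
  proof (rule analytic_continuation[of f "{s. Re s > 1}" "of_real ` {1<..<2}" "of_real (3 / 2)"])
    show "f holomorphic_on {s. Re s > 1}"
      unfolding f_def
      by (intro holomorphic_intros dirichlet_zeta_holomorphic holomorphic_on_subset[OF newton_series_holomorphic])
        auto
    show "open {s. Re s > 1}" by (rule open_halfspace_Re_gt)
    show "connected {s. Re s > 1}" by (intro convex_connected convex_halfspace_Re_gt)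
    have "(3 / 2 :: real) islimpt {1<..<2}"
      by (simp add: islimpt_greaterThanLessThan1 open_imp_islimpt)
    then show "(of_real (3 / 2) :: complex) islimpt of_real ` {1<..<2}"
    proof (rule islimpt_isCont_image)
      show "\<forall>\<^sub>F y in at (3 / 2). (of_real y :: complex) \<noteq> of_real (3 / 2)"
        unfolding of_real_eq_iff eventually_at_filter by simp
    qed (intro continuous_intros)
    show "f z = 0" if z: "z \<in> of_real ` {1<..<2}" for z
    proof -
      obtain x :: real where x: "z = of_real x" "1 < x" "x < 2" using z by auto
      show ?thesis
        unfolding f_def x(1) newton_series_of_real[OF x(2,3)] dirichlet_zeta_of_real[OF x(2)] by simp
    qed
  qed (use assms in auto)
  then show ?thesis by (simp add: f_def)
qed

text \<open>The Newton series plus the pole term is itself an analytic continuation of the Dirichlet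
  series. This settles existence for the choice in \<open>zeta\<close>, and uniqueness away from 1
  gives the equality.\<close>

lemma zeta_eq_newton_series:
  assumes "s \<noteq> 1"
  shows "zeta s = newton_series s + 1 / (s - 1)"
proof (rule zeta_eqI[OF _ assms])
  show "is_zeta_continuation (\<lambda>s. newton_series s + 1 / (s - 1))"
    unfolding is_zeta_continuation_def
  proof (intro conjI allI impI)
    show "(\<lambda>s. newton_series s + 1 / (s - 1)) holomorphic_on - {1}"
      by (intro holomorphic_intros holomorphic_on_subset[OF newton_series_holomorphic]) auto
    show "(\<lambda>n. 1 / of_nat (Suc n) powr s) sums (newton_series s + 1 / (s - 1))" if "1 < Re s" for s
      unfolding newton_series_eq_dirichlet_zeta[OF that] by (rule dirichlet_zeta_sums[OF that])
  qed
qed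

lemma zeta_reg_eq_newton_series: "zeta_reg s = newton_series s"
  by (simp add: zeta_reg_def zeta_eq_newton_series newton_series_1)

section \<open>Binomial inversion and conclusion\<close>

text \<open>The orthogonality behind binomial inversion: binom(n,k) binom(k,i) = binom(n,i)
  binom(n-i,k-i), and the remaining alternating row sum vanishes unless n-i = 0.\<close>

lemma sum_alternating_binomial_product:
  assumes "i \<le> n"
  shows "(\<Sum>k\<le>n. (-1) ^ k * of_nat (n choose k) * of_nat (k choose i))
    = (if i = n then (-1) ^ n else (0 :: 'a :: comm_ring_1))"
proof -
  have "(\<Sum>k\<le>n. (-1) ^ k * of_nat (n choose k) * of_nat (k choose i))
      = (\<Sum>k\<in>{i..n}. (-1) ^ k * of_nat ((n choose k) * (k choose i)) :: 'a)"
    by (intro sum.mono_neutral_cong_right) (auto simp: mult.assoc not_le binomial_eq_0)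
  also have "\<dots> = (\<Sum>k\<le>n - i. (-1) ^ (k + i) * of_nat ((n choose (k + i)) * ((k + i) choose i)))"
    using assms
    by (intro sum.reindex_bij_witness[of _ "\<lambda>k. k + i" "\<lambda>k. k - i"]) auto
  also have "\<dots> = (\<Sum>k\<le>n - i. ((-1) ^ i * of_nat (n choose i)) * ((-1) ^ k * of_nat ((n - i) choose k)))"
  proof (rule sum.cong)
    fix k assume "k \<in> {..n - i}"
    then have "(n choose (k + i)) * ((k + i) choose i) = (n choose i) * ((n - i) choose k)"
      using assms choose_mult[of i "k + i" n] by simp
    then show "(-1) ^ (k + i) * of_nat ((n choose (k + i)) * ((k + i) choose i))
        = ((-1) ^ i * of_nat (n choose i)) * ((-1) ^ k * of_nat ((n - i) choose k) :: 'a)"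
      by (simp add: power_add mult_ac)
  qed simp
  also have "\<dots> = (-1) ^ i * of_nat (n choose i) * (\<Sum>k\<le>n - i. (-1) ^ k * of_nat ((n - i) choose k))"
    by (rule sum_distrib_left[symmetric])
  finally show ?thesis
    using assms choose_alternating_sum[of "n - i", where 'a = 'a] by auto
qed

lemma newton_coeff_eq: "newton_coeff n = of_real (newton_b n)"
proof -
  \<comment> \<open>The inner sum is extended from i \<le> k to i \<le> n by zero terms, so that its
    range no longer depends on \<open>k\<close> and the two sums can be swapped.\<close>
  have "zeta_reg (of_nat k) = (\<Sum>i\<le>n. (-1) ^ i * of_real (newton_b i) * of_nat (k choose i))"
    if "k \<le> n" for k
    unfolding zeta_reg_eq_newton_series newton_series_of_nat
    using that by (intro sum.mono_neutral_left) auto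
  then have "newton_coeff n = (\<Sum>k\<le>n. of_nat (n choose k) * (-1) ^ k *
      (\<Sum>i\<le>n. (-1) ^ i * of_real (newton_b i) * of_nat (k choose i)))"
    unfolding newton_coeff_def by simp
  also have "\<dots> = (\<Sum>k\<le>n. \<Sum>i\<le>n. (-1) ^ i * of_real (newton_b i) *
      ((-1) ^ k * of_nat (n choose k) * of_nat (k choose i)))"
    by (simp add: sum_distrib_left mult_ac)
  also have "\<dots> = (\<Sum>i\<le>n. (-1) ^ i * of_real (newton_b i) *
      (\<Sum>k\<le>n. (-1) ^ k * of_nat (n choose k) * of_nat (k choose i)))"
    by (subst sum.swap) (simp add: sum_distrib_left)
  also have "\<dots> = (\<Sum>i\<le>n. if i = n then of_real (newton_b n) else 0)"
    by (intro sum.cong) (auto simp: sum_alternating_binomial_product mult.left_commute power_mult_distrib[symmetric])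
  finally show ?thesis by simp
qed

theorem corollary1:
  shows "((\<lambda>s. zeta s - 1 / (s - 1)) \<longlongrightarrow> euler_mascheroni) (at 1) \<and>
    (\<forall>s :: complex.
      summable (\<lambda>n. (-1) ^ n * newton_coeff n * (s gchoose n)) \<and>
      (if s = 1 then euler_mascheroni else zeta s - 1 / (s - 1)) =
        (\<Sum>n. (-1) ^ n * newton_coeff n * (s gchoose n)))"
proof (intro conjI allI)
  \<comment> \<open>The limit at 1 is read off from continuity of the entire series, which agrees
    with the regularised zeta function on a punctured neighbourhood.\<close>
  have "isCont newton_series 1"
    using newton_series_holomorphic holomorphic_on_imp_continuous_on continuous_on_eq_continuous_at by blast
  then have "(newton_series \<longlongrightarrow> euler_mascheroni) (at 1)"
    by (simp add: isCont_def newton_series_1)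
  then show "((\<lambda>s. zeta s - 1 / (s - 1)) \<longlongrightarrow> euler_mascheroni) (at 1)"
    by (rule Lim_transform_eventually) (auto simp: eventually_at_filter zeta_eq_newton_series)
  fix s :: complex
  have sums: "(\<lambda>n. (-1) ^ n * newton_coeff n * (s gchoose n)) sums newton_series s"
    using newton_series_sums[of s] by (simp add: newton_term_def newton_coeff_eq)
  then show "summable (\<lambda>n. (-1) ^ n * newton_coeff n * (s gchoose n))"
    by (rule sums_summable)
  show "(if s = 1 then euler_mascheroni else zeta s - 1 / (s - 1))
      = (\<Sum>n. (-1) ^ n * newton_coeff n * (s gchoose n))"
    unfolding sums_unique[OF sums, symmetric]
    by (simp add: zeta_eq_newton_series newton_series_1)
qed

end
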